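(* Let $n\ge 3$ be an integer, $\eta>0$, $\rho_1>0$, $\beta_0>0$ and $\alpha_0=2\beta_0+\rho_1$. Then there exists a unique function $g\in C^2((0,\infty))$ satisfying $$\left(\frac{g_r}{g}\right)_r+\frac{n-1}{r}\cdot\frac{g_r}{g}+\alpha_0 g+\beta_0 r g_r=0,\qquad g>0,\qquad\text{in }(0,\infty)$$ and $$\lim_{r\to 0^+}r^{\alpha_0/\beta_0}g(r)=\eta.$$
   Context: Subscripts $r$ denote differentiation with respect to $r$. The equation is the radial form of $\Delta\log g+\alpha_0 g+\beta_0 x\cdot\nabla g=0$, $g>0$, in $\mathbb{R}^n\setminus\{0\}$. *)

theory Defs
  imports "HOL-Analysis.Analysis"
begin

(* Intended for open S only: there "differentiable_on" and the two-sided "deriv" agree. *)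
definition Ck_on :: "nat \<Rightarrow> real set \<Rightarrow> (real \<Rightarrow> real) \<Rightarrow> bool" where
  "Ck_on k S f \<longleftrightarrow>
     (\<forall>j<k. (deriv ^^ j) f differentiable_on S) \<and> continuous_on S ((deriv ^^ k) f)"

definition radial_eq_at :: "nat \<Rightarrow> real \<Rightarrow> real \<Rightarrow> (real \<Rightarrow> real) \<Rightarrow> real \<Rightarrow> bool" where
  "radial_eq_at n \<alpha>\<^sub>0 \<beta>\<^sub>0 g r \<longleftrightarrow>
     deriv (\<lambda>s. deriv g s / g s) r + (real n - 1) / r * (deriv g r / g r)
       + \<alpha>\<^sub>0 * g r + \<beta>\<^sub>0 * r * deriv g r = 0"

(* Only the values of g on (0,\<infinity>) matter; the library functions are total. *)
definition singular_solution ::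
    "nat \<Rightarrow> real \<Rightarrow> real \<Rightarrow> real \<Rightarrow> (real \<Rightarrow> real) \<Rightarrow> bool" where
  "singular_solution n \<alpha>\<^sub>0 \<beta>\<^sub>0 \<eta> g \<longleftrightarrow>
     Ck_on 2 {0<..} g \<and>
     (\<forall>r>0. g r > 0 \<and> radial_eq_at n \<alpha>\<^sub>0 \<beta>\<^sub>0 g r) \<and>
     ((\<lambda>r. r powr (\<alpha>\<^sub>0 / \<beta>\<^sub>0) * g r) \<longlongrightarrow> \<eta>) (at_right 0)"

end

theory Submission
  imports Defs
begin

text \<open>
  Put \<open>\<gamma> = \<alpha>\<^sub>0 / \<beta>\<^sub>0 > 2\<close> and write \<open>g r = \<eta> * r powr (- \<gamma>) * exp (u r)\<close>. The prescribed behaviour of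
  \<open>g\<close> at \<open>0\<close> becomes \<open>u r \<rightarrow> 0\<close>, and since \<open>\<alpha>\<^sub>0 g + \<beta>\<^sub>0 r g\<^sub>r\<close> vanishes on the pure power, the
  equation becomes
  \<open>u'' + (N / r + b r^{-\<kappa>-1} e^u) u' = A / r\<^sup>2\<close>,
  where \<open>N = n - 1\<close>, \<open>\<kappa> = \<gamma> - 2\<close>, \<open>b = \<beta>\<^sub>0 \<eta>\<close> and \<open>A = \<gamma> (n - 2)\<close>. In this form \<open>u\<close> itself enters
  only through the coefficient of \<open>u'\<close> (\<open>damping\<close> below): freezing \<open>u\<close> there leaves a linear first
  order equation for \<open>u'\<close>. The damping is so strong at \<open>0\<close> that exactly one solution of the linear
  equation is integrable there, so the initial value problem at the singular point is well posed.

  Balancing \<open>b r^{-\<kappa>-1} u'\<close> against \<open>A / r\<^sup>2\<close> suggests \<open>u' = (A / b) r^{\<kappa>-1}\<close>. The function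
  \<open>barrier r = A / (b * \<kappa>) * r powr \<kappa>\<close> with this derivative is a supersolution for every frozen
  \<open>u \<ge> 0\<close>. Therefore freezing \<open>u\<close> and solving maps the set of continuous functions between \<open>0\<close> and
  \<open>barrier\<close> into itself (\<open>linear_step_exists\<close>). The map is a contraction with factor 1/2 on the whole
  half-line with respect to the weighted supremum norm of \<open>u / weight\<close>, where
  \<open>weight = exp (2 * exp barrier)\<close> (\<open>contraction\<close>). Hence a global fixed point is obtained directly,
  with no continuation of local solutions (\<open>fixed_point_exists\<close>), and it is the only one
  (\<open>fixed_point_unique\<close>).

  Uniqueness among all solutions needs in addition that the single condition \<open>u \<rightarrow> 0\<close> forces
  \<open>0 \<le> u \<le> barrier\<close>, although it says nothing about \<open>u'\<close>. The reason is that any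
  other value of the limit of \<open>E u'\<close> at \<open>0\<close>, where \<open>E\<close> is the integrating factor, would make \<open>u'\<close> at
  least of size \<open>1 / r\<close> and \<open>u\<close> logarithmically unbounded (\<open>solution_bounded\<close>).
\<close>

section \<open>Calculus on the positive half-line\<close>

lemma antiderivative_on_pos:
  fixes f :: "real \<Rightarrow> real"
  assumes "continuous_on {0<..} f"
  shows "\<exists>F. \<forall>r>0. (F has_real_derivative f r) (at r)"
proof -
  have "isCont f x" if "0 < x" for x
    using assms that by (simp add: continuous_on_eq_continuous_at)
  then have "\<exists>F. \<forall>x::real. ereal 0 < x \<longrightarrow> x < \<infinity> \<longrightarrow> (F has_vector_derivative f x) (at x)"
    by (intro einterval_antiderivative) auto
  then show ?thesis
    by (simp add: has_real_derivative_iff_has_vector_derivative)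
qed

lemma monotone_on_pos:
  fixes y :: "real \<Rightarrow> real"
  assumes "\<And>r. r > 0 \<Longrightarrow> (y has_real_derivative y' r) (at r)"
    and "\<And>r. r > 0 \<Longrightarrow> 0 \<le> y' r" and "0 < s" "s \<le> r"
  shows "y s \<le> y r"
proof (rule DERIV_nonneg_imp_nondecreasing[OF \<open>s \<le> r\<close>])
  fix x assume "s \<le> x" "x \<le> r"
  then have "x > 0" using \<open>0 < s\<close> by simp
  then show "\<exists>z. DERIV y x :> z \<and> z \<ge> 0"
    using assms(1,2) by blast
qed

lemma nonpos_if_decreasing_from_zero:
  fixes y :: "real \<Rightarrow> real"
  assumes der: "\<And>r. r > 0 \<Longrightarrow> (y has_real_derivative y' r) (at r)"
    and le: "\<And>r. r > 0 \<Longrightarrow> y' r \<le> 0"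
    and lim: "(y \<longlongrightarrow> 0) (at_right 0)" and r: "r > 0"
  shows "y r \<le> 0"
proof -
  have "y r \<le> y s" if "0 < s" "s \<le> r" for s
    using monotone_on_pos[of "\<lambda>r. - y r" "\<lambda>r. - y' r" s r, OF DERIV_minus[OF der]] le that
    by simp
  then have "eventually (\<lambda>s. y r \<le> y s) (at_right 0)"
    unfolding eventually_at_right_field using r by (intro exI[of _ r]) auto
  then show ?thesis
    by (rule tendsto_lowerbound[OF lim]) simp
qed

text \<open>Domination by \<open>H \<ge> 0\<close> keeps any antiderivative of \<open>g\<close> bounded below near \<open>0\<close>, so that
  its infimum can be subtracted. This replaces the improper integral of \<open>g\<close> from \<open>0\<close>.\<close>

lemma dominated_antiderivative:
  fixes g :: "real \<Rightarrow> real"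
  assumes cont: "continuous_on {0<..} g"
    and H: "\<And>r. r > 0 \<Longrightarrow> (H has_real_derivative h r) (at r)"
    and g: "\<And>r. r > 0 \<Longrightarrow> 0 \<le> g r" "\<And>r. r > 0 \<Longrightarrow> g r \<le> h r"
    and H0: "\<And>r. r > 0 \<Longrightarrow> 0 \<le> H r"
  shows "\<exists>G. \<forall>r>0. (G has_real_derivative g r) (at r) \<and> 0 \<le> G r \<and> G r \<le> H r"
proof -
  obtain G where G: "\<And>r. r > 0 \<Longrightarrow> (G has_real_derivative g r) (at r)"
    using antiderivative_on_pos[OF cont] by auto
  have mono: "G s \<le> G r" if "0 < s" "s \<le> r" for s r
    by (rule monotone_on_pos[OF G g(1) that])
  have mono': "H s - G s \<le> H r - G r" if "0 < s" "s \<le> r" for s r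
    using monotone_on_pos[of "\<lambda>r. H r - G r" "\<lambda>r. h r - g r" s r, OF DERIV_diff[OF H G]] g(2) that
    by simp
  have lower: "G r - H r \<le> G s" if "0 < s" "0 < r" for s r
    using mono[of r s] mono'[of s r] H0[of r] H0[of s] that by linarith
  define l where "l = (INF s\<in>{0<..}. G s)"
  have bdd: "bdd_below (G ` {0<..})"
    using lower[of _ 1] by (intro bdd_belowI2[of _ "G 1 - H 1"]) auto
  have "l \<le> G r" "G r - H r \<le> l" if "r > 0" for r
    unfolding l_def using that lower bdd by (auto intro!: cINF_lower cINF_greatest)
  then have "0 \<le> G r - l \<and> G r - l \<le> H r" if "r > 0" for r
    using that by (smt (verit))
  moreover have "((\<lambda>r. G r - l) has_real_derivative g r) (at r)" if "r > 0" for r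
    using G[OF that] by (auto intro!: derivative_eq_intros)
  ultimately show ?thesis by blast
qed

text \<open>The bound \<open>E r \<le> C * r powr N\<close> makes it possible to check \<open>E * y \<rightarrow> 0\<close> at the singular point from
  the growth of \<open>y\<close>, for a coefficient \<open>a\<close> that may be much more singular than \<open>N / r\<close>.\<close>

lemma integrating_factor:
  fixes a :: "real \<Rightarrow> real"
  assumes cont: "continuous_on {0<..} a" and a: "\<And>r. r > 0 \<Longrightarrow> N / r \<le> a r"
  shows "\<exists>E C. (\<forall>r>0. E r > 0 \<and> (E has_real_derivative a r * E r) (at r)) \<and> C > 0 \<and>
           (\<forall>r. 0 < r \<and> r \<le> 1 \<longrightarrow> E r \<le> C * r powr N)"
proof -
  obtain P where P: "\<And>r. r > 0 \<Longrightarrow> (P has_real_derivative a r) (at r)"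
    using antiderivative_on_pos[OF cont] by auto
  have "P r \<le> P 1 + N * ln r" if "0 < r" "r \<le> 1" for r
    using monotone_on_pos[of "\<lambda>r. P r - N * ln r" "\<lambda>r. a r - N / r" r 1] P a that
    by (force intro!: derivative_eq_intros)
  then have "exp (P r) \<le> exp (P 1) * r powr N" if "0 < r" "r \<le> 1" for r
    using that by (simp add: powr_def mult.commute flip: exp_add)
  moreover have "((\<lambda>r. exp (P r)) has_real_derivative a r * exp (P r)) (at r)" if "r > 0" for r
    using P[OF that] by (auto intro!: derivative_eq_intros)
  ultimately show ?thesis
    by (intro exI[of _ "\<lambda>r. exp (P r)"] exI[of _ "exp (P 1)"]) auto
qed

text \<open>The product \<open>E * y\<close> is nonincreasing and starts from \<open>0\<close>. Its limit at \<open>0\<close> takes the place of an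
  initial value, which a coefficient singular at \<open>0\<close> does not admit.\<close>

lemma comparison_with_factor:
  fixes y :: "real \<Rightarrow> real"
  assumes E: "\<And>r. r > 0 \<Longrightarrow> E r > 0" "\<And>r. r > 0 \<Longrightarrow> (E has_real_derivative a r * E r) (at r)"
    and y: "\<And>r. r > 0 \<Longrightarrow> (y has_real_derivative y' r) (at r)"
    and le: "\<And>r. r > 0 \<Longrightarrow> y' r + a r * y r \<le> 0"
    and lim: "((\<lambda>r. E r * y r) \<longlongrightarrow> 0) (at_right 0)" and r: "r > 0"
  shows "y r \<le> 0"
proof -
  have "((\<lambda>r. E r * y r) has_real_derivative E r * (y' r + a r * y r)) (at r)" if "r > 0" for r
    using E(2)[OF that] y[OF that] by (auto intro!: derivative_eq_intros simp: algebra_simps)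
  then have "E r * y r \<le> 0"
    using E(1) le lim r
    by (intro nonpos_if_decreasing_from_zero[of "\<lambda>r. E r * y r" "\<lambda>r. E r * (y' r + a r * y r)"])
      (auto simp: mult_nonneg_nonpos order_less_imp_le)
  then show ?thesis
    using E(1)[OF r] by (simp add: mult_le_0_iff)
qed

text \<open>The same principle with an explicit power in place of the integrating factor, so that it applies
  to functions with known growth.\<close>

lemma comparison:
  fixes y :: "real \<Rightarrow> real"
  assumes cont: "continuous_on {0<..} a" and a: "\<And>r. r > 0 \<Longrightarrow> N / r \<le> a r"
    and y: "\<And>r. r > 0 \<Longrightarrow> (y has_real_derivative y' r) (at r)"
    and le: "\<And>r. r > 0 \<Longrightarrow> y' r + a r * y r \<le> 0"
    and lim: "((\<lambda>r. r powr N * y r) \<longlongrightarrow> 0) (at_right 0)" and r: "r > 0"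
  shows "y r \<le> 0"
proof -
  obtain E C where E: "\<And>r. r > 0 \<Longrightarrow> E r > 0"
      "\<And>r. r > 0 \<Longrightarrow> (E has_real_derivative a r * E r) (at r)"
    and C: "C > 0" "\<And>r. 0 < r \<Longrightarrow> r \<le> 1 \<Longrightarrow> E r \<le> C * r powr N"
    using integrating_factor[of a N, OF cont a] by blast
  have "((\<lambda>r. E r * y r) \<longlongrightarrow> 0) (at_right 0)"
  proof (rule Lim_null_comparison)
    show "((\<lambda>r. C * \<bar>r powr N * y r\<bar>) \<longlongrightarrow> 0) (at_right 0)"
      using lim by (intro tendsto_mult_right_zero tendsto_rabs_zero)
    have "norm (E r * y r) \<le> C * \<bar>r powr N * y r\<bar>" if "0 < r" "r \<le> 1" for r
      using mult_right_mono[OF C(2)[OF that], of "\<bar>y r\<bar>"] E(1)[of r] that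
      by (simp add: abs_mult mult.assoc)
    then show "eventually (\<lambda>r. norm (E r * y r) \<le> C * \<bar>r powr N * y r\<bar>) (at_right 0)"
      unfolding eventually_at_right_field by (intro exI[of _ 1]) auto
  qed
  then show ?thesis
    using comparison_with_factor[OF E y le] r by blast
qed

text \<open>Otherwise \<open>u - c * ln\<close> would be nondecreasing near \<open>0\<close>, and \<open>u\<close> would tend to \<open>-\<infinity>\<close>
  like \<open>c * ln r\<close>.\<close>

lemma convergent_derivative_not_above_inverse:
  fixes u :: "real \<Rightarrow> real"
  assumes u: "\<And>r. r > 0 \<Longrightarrow> (u has_real_derivative q r) (at r)"
    and lim: "(u \<longlongrightarrow> l) (at_right 0)" and "c > 0" "R > 0"
  shows "\<exists>r. 0 < r \<and> r \<le> R \<and> q r < c / r"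
proof (rule ccontr)
  assume "\<not> ?thesis"
  then have q: "q r \<ge> c / r" if "0 < r" "r \<le> R" for r
    using that by force
  have "u r \<le> u R - c * ln R + c * ln r" if "0 < r" "r \<le> R" for r
  proof -
    have "u r - c * ln r \<le> u R - c * ln R"
    proof (rule DERIV_nonneg_imp_nondecreasing[OF that(2)])
      fix x assume "r \<le> x" "x \<le> R"
      then show "\<exists>y. DERIV (\<lambda>r. u r - c * ln r) x :> y \<and> y \<ge> 0"
        using u[of x] q[of x] that
        by (intro exI[of _ "q x - c / x"]) (auto intro!: derivative_eq_intros)
    qed
    then show ?thesis by simp
  qed
  then have "eventually (\<lambda>r. u r - c * ln r \<le> u R - c * ln R) (at_right 0)"
    unfolding eventually_at_right_field using \<open>R > 0\<close> by (intro exI[of _ R]) (auto simp: algebra_simps)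
  moreover have "filterlim (\<lambda>r. u r + c * (- ln r)) at_top (at_right 0)"
    by (intro filterlim_tendsto_add_at_top[OF lim]
        filterlim_tendsto_pos_mult_at_top[OF tendsto_const \<open>c > 0\<close>]
        filterlim_compose[OF filterlim_uminus_at_top_at_bot ln_at_0])
  then have "eventually (\<lambda>r. u r + c * (- ln r) > u R - c * ln R) (at_right 0)"
    by (simp add: filterlim_at_top_dense)
  ultimately have "eventually (\<lambda>r::real. False) (at_right 0)"
    by eventually_elim auto
  then show False by simp
qed

lemma geometric_limit:
  fixes s :: "nat \<Rightarrow> real"
  assumes step: "\<And>k. \<bar>s (Suc k) - s k\<bar> \<le> (1/2)^k * C"
  shows "\<exists>l. \<forall>k. \<bar>l - s k\<bar> \<le> 2 * (1/2)^k * C"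
proof -
  define d where "d k = s (Suc k) - s k" for k
  have sg: "(\<lambda>j. (1/2)^(j+k) * C) sums (2 * (1/2)^k * C)" for k
    using sums_mult2[OF geometric_sums[of "1/2::real"], of "(1/2)^k * C"]
    by (simp add: power_add mult_ac)
  have d: "norm (d (j + k)) \<le> (1/2)^(j+k) * C" for j k
    using step[of "j+k"] by (simp add: d_def)
  have summ: "summable d"
    using summable_comparison_test'[OF sums_summable[OF sg[of 0]], of 0 d] d[of _ 0] by auto
  have tele: "(\<Sum>i<k. d i) = s k - s 0" for k
    by (simp add: d_def sum_lessThan_telescope)
  have "\<bar>s 0 + suminf d - s k\<bar> \<le> 2 * (1/2)^k * C" for k
  proof -
    have "s 0 + suminf d - s k = (\<Sum>j. d (j + k))"
      using suminf_split_initial_segment[OF summ, of k] tele[of k] by simp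
    also have "\<bar>\<dots>\<bar> \<le> (\<Sum>j. (1/2)^(j+k) * C)"
      using norm_suminf_le[OF d sums_summable[OF sg]] by simp
    also have "\<dots> = 2 * (1/2)^k * C"
      using sums_unique[OF sg[of k]] by simp
    finally show ?thesis .
  qed
  then show ?thesis by blast
qed

lemma exp_diff_le:
  fixes x y z D :: real
  assumes "x \<le> z" "y \<le> z" "x - y \<le> D" "0 \<le> D"
  shows "exp x - exp y \<le> exp z * D"
proof -
  have "exp x - exp y = exp x * (1 - exp (y - x))"
    by (simp add: algebra_simps flip: exp_add)
  also have "\<dots> \<le> exp x * D"
    using exp_ge_add_one_self[of "y - x"] assms by (intro mult_left_mono) (linarith, simp)
  also have "\<dots> \<le> exp z * D"
    using assms by (intro mult_right_mono) auto
  finally show ?thesis .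
qed

section \<open>The desingularised equation\<close>

locale profile_equation =
  fixes N \<kappa> b A :: real
  assumes N: "N \<ge> 1" and \<kappa>: "\<kappa> > 0" and b: "b > 0" and A: "A > 0"
begin

definition damping :: "(real \<Rightarrow> real) \<Rightarrow> real \<Rightarrow> real" where
  "damping u r = N / r + b * r powr (- \<kappa> - 1) * exp (u r)"

text \<open>The integral from \<open>0\<close> of the function that balances the singular part of the damping, with
  \<open>exp (u r)\<close> replaced by \<open>1\<close>, against the right-hand side \<open>A / r\<^sup>2\<close> (\<open>barrier'_balance\<close>).\<close>

definition barrier :: "real \<Rightarrow> real" where
  "barrier r = A / (b * \<kappa>) * r powr \<kappa>"

definition barrier' :: "real \<Rightarrow> real" where
  "barrier' r = A / b * r powr (\<kappa> - 1)"

text \<open>Chosen so that \<open>weight' = 2 * exp barrier * barrier' * weight\<close>. The Lipschitz constant of \<open>exp\<close>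
  on \<open>[0, barrier r]\<close> is \<open>exp (barrier r)\<close>, so a Gronwall argument for the error of the iteration needs
  a weight with logarithmic derivative a multiple of \<open>exp barrier * barrier'\<close>; the multiple
  2 gives the contraction factor 1/2.\<close>

definition weight :: "real \<Rightarrow> real" where
  "weight r = exp (2 * exp (barrier r))"

text \<open>The equation for \<open>w\<close> with the damping frozen at \<open>u\<close>, written as a first order system with
  \<open>q = w'\<close>. Solutions of the nonlinear equation are the case \<open>w = u\<close>.\<close>

definition linear_step :: "(real \<Rightarrow> real) \<Rightarrow> (real \<Rightarrow> real) \<Rightarrow> (real \<Rightarrow> real) \<Rightarrow> bool" where
  "linear_step u w q \<longleftrightarrow> (\<forall>r>0. (w has_real_derivative q r) (at r) \<and>
     (q has_real_derivative A / r\<^sup>2 - damping u r * q r) (at r))"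

definition bounded_step :: "(real \<Rightarrow> real) \<Rightarrow> (real \<Rightarrow> real) \<Rightarrow> (real \<Rightarrow> real) \<Rightarrow> bool" where
  "bounded_step u w q \<longleftrightarrow> linear_step u w q \<and>
     (\<forall>r>0. 0 \<le> w r \<and> w r \<le> barrier r \<and> 0 \<le> q r \<and> q r \<le> barrier' r)"

definition admissible :: "(real \<Rightarrow> real) \<Rightarrow> bool" where
  "admissible u \<longleftrightarrow> continuous_on {0<..} u \<and> (\<forall>r>0. 0 \<le> u r \<and> u r \<le> barrier r)"

lemma damping_ge: "r > 0 \<Longrightarrow> N / r \<le> damping u r"
  using b by (simp add: damping_def)

lemma continuous_on_damping:
  "continuous_on {0<..} u \<Longrightarrow> continuous_on {0<..} (damping u)"
  unfolding damping_def by (intro continuous_intros) auto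

lemma barrier_deriv: "r > 0 \<Longrightarrow> (barrier has_real_derivative barrier' r) (at r)"
  unfolding barrier_def[abs_def] barrier'_def
  using DERIV_cmult[OF has_real_derivative_powr[of r \<kappa>], of "A / (b * \<kappa>)"] \<kappa>
  by simp

lemma barrier'_deriv: "r > 0 \<Longrightarrow> (barrier' has_real_derivative (\<kappa> - 1) / r * barrier' r) (at r)"
  unfolding barrier'_def[abs_def]
  using DERIV_cmult[OF has_real_derivative_powr[of r "\<kappa> - 1"], of "A / b"]
  by (simp add: powr_diff field_simps power2_eq_square)

lemma barrier_nonneg: "barrier r \<ge> 0"
  using A b \<kappa> by (simp add: barrier_def)

lemma barrier'_nonneg: "barrier' r \<ge> 0"
  using A b by (simp add: barrier'_def)

lemma barrier'_balance:
  assumes "r > 0"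
  shows "b * r powr (- \<kappa> - 1) * barrier' r = A / r\<^sup>2"
proof -
  have "r powr (- \<kappa> - 1) * r powr (\<kappa> - 1) = r powr - 2"
    by (simp flip: powr_add)
  also have "\<dots> = 1 / r\<^sup>2"
    using assms powr_realpow[of r 2] by (simp add: powr_minus_divide)
  finally show ?thesis
    using b by (simp add: barrier'_def mult.left_commute)
qed

text \<open>The singular part of the damping alone already produces \<open>A / r\<^sup>2\<close>, because
  \<open>exp (u r) \<ge> 1\<close>; the remaining terms have the sign of \<open>\<kappa> - 1 + N > 0\<close>.\<close>

lemma supersolution:
  assumes "r > 0" "u r \<ge> 0"
  shows "A / r\<^sup>2 \<le> (\<kappa> - 1) / r * barrier' r + damping u r * barrier' r"
proof -
  have "b * r powr (- \<kappa> - 1) * barrier' r * 1 \<le> b * r powr (- \<kappa> - 1) * barrier' r * exp (u r)"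
    using assms b barrier'_nonneg[of r] by (intro mult_left_mono) auto
  moreover have "0 \<le> (\<kappa> - 1 + N) / r * barrier' r"
    using assms \<kappa> N barrier'_nonneg[of r] by simp
  moreover have "(\<kappa> - 1) / r * barrier' r + damping u r * barrier' r
      = (\<kappa> - 1 + N) / r * barrier' r + b * r powr (- \<kappa> - 1) * barrier' r * exp (u r)"
    by (simp add: damping_def algebra_simps add_divide_distrib diff_divide_distrib)
  ultimately show ?thesis
    using barrier'_balance[OF assms(1)] by simp
qed

lemma barrier_tendsto: "(barrier \<longlongrightarrow> 0) (at_right 0)"
proof -
  have "((\<lambda>r. A / (b * \<kappa>) * r powr \<kappa>) \<longlongrightarrow> A / (b * \<kappa>) * 0) (at_right 0)"
    using \<kappa> by (intro tendsto_mult tendsto_const tendsto_zero_powrI[OF tendsto_ident_at tendsto_const])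
      (auto simp: eventually_at_filter)
  then show ?thesis by (simp add: barrier_def[abs_def])
qed

lemma barrier'_tendsto: "((\<lambda>r. r powr N * barrier' r) \<longlongrightarrow> 0) (at_right 0)"
proof -
  have "((\<lambda>r. A / b * r powr (N + \<kappa> - 1)) \<longlongrightarrow> A / b * 0) (at_right 0)"
    using \<kappa> N by (intro tendsto_mult tendsto_const tendsto_zero_powrI[OF tendsto_ident_at tendsto_const])
      (auto simp: eventually_at_filter)
  moreover have "r powr N * barrier' r = A / b * r powr (N + \<kappa> - 1)" for r
    by (simp add: barrier'_def algebra_simps flip: powr_add)
  ultimately show ?thesis by simp
qed

text \<open>Variation of constants: \<open>q = G / E\<close> with \<open>G' = E * A / r\<^sup>2\<close>. The supersolution property says
  that \<open>E * barrier'\<close> grows faster than \<open>G\<close>, which both selects the right constant of integration and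
  bounds \<open>q\<close> by \<open>barrier'\<close>. Integrating once more gives \<open>w\<close>.\<close>

lemma linear_step_exists:
  assumes "admissible u"
  shows "\<exists>w q. bounded_step u w q"
proof -
  have cont: "continuous_on {0<..} (damping u)" and u: "\<And>r. r > 0 \<Longrightarrow> u r \<ge> 0"
    using assms by (auto simp: admissible_def continuous_on_damping)
  obtain E where E: "\<And>r. r > 0 \<Longrightarrow> E r > 0"
      "\<And>r. r > 0 \<Longrightarrow> (E has_real_derivative damping u r * E r) (at r)"
    using integrating_factor[OF cont damping_ge] by blast
  have contE: "continuous_on {0<..} E"
    using E(2) by (intro DERIV_continuous_on) (auto intro: has_field_derivative_at_within)
  have "\<exists>G. \<forall>r>0. (G has_real_derivative E r * (A / r\<^sup>2)) (at r) \<and> 0 \<le> G r \<and> G r \<le> E r * barrier' r"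
  proof (rule dominated_antiderivative)
    show "continuous_on {0<..} (\<lambda>r. E r * (A / r\<^sup>2))"
      by (intro continuous_intros contE) auto
    fix r :: real assume r: "r > 0"
    show "((\<lambda>r. E r * barrier' r) has_real_derivative
             E r * ((\<kappa> - 1) / r * barrier' r + damping u r * barrier' r)) (at r)"
      using E(2)[OF r] barrier'_deriv[OF r]
      by (auto intro!: derivative_eq_intros simp: algebra_simps)
    show "E r * (A / r\<^sup>2) \<le> E r * ((\<kappa> - 1) / r * barrier' r + damping u r * barrier' r)"
      using E(1)[OF r] supersolution[of r u, OF r u[OF r]] by (intro mult_left_mono) auto
    show "0 \<le> E r * (A / r\<^sup>2)" "0 \<le> E r * barrier' r"
      using E(1)[OF r] A barrier'_nonneg[of r] by auto
  qed
  then obtain G where G: "\<And>r. r > 0 \<Longrightarrow> (G has_real_derivative E r * (A / r\<^sup>2)) (at r)"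
      "\<And>r. r > 0 \<Longrightarrow> 0 \<le> G r" "\<And>r. r > 0 \<Longrightarrow> G r \<le> E r * barrier' r"
    by blast
  define q where "q r = G r / E r" for r
  have q: "(q has_real_derivative A / r\<^sup>2 - damping u r * q r) (at r)" if r: "r > 0" for r
    unfolding q_def[abs_def] using G(1)[OF r] E[OF r] r
    by (auto intro!: derivative_eq_intros simp: field_simps)
  have q_bounds: "0 \<le> q r" "q r \<le> barrier' r" if "r > 0" for r
    using G(2,3)[OF that] E(1)[OF that] by (auto simp: q_def field_simps)
  have "continuous_on {0<..} q"
    using q by (intro DERIV_continuous_on) (auto intro: has_field_derivative_at_within)
  then obtain w where "\<And>r. r > 0 \<Longrightarrow> (w has_real_derivative q r) (at r) \<and> 0 \<le> w r \<and> w r \<le> barrier r"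
    using dominated_antiderivative[of q barrier barrier', OF _ barrier_deriv q_bounds barrier_nonneg] by blast
  then show ?thesis
    using q q_bounds unfolding bounded_step_def linear_step_def by blast
qed

lemma bounded_step_admissible: "bounded_step u w q \<Longrightarrow> admissible w"
  unfolding bounded_step_def linear_step_def admissible_def
  by (auto intro!: DERIV_continuous_on intro: has_field_derivative_at_within)

lemma bounded_tendsto_zero:
  assumes "\<And>r. r > 0 \<Longrightarrow> 0 \<le> w r \<and> w r \<le> barrier r"
  shows "(w \<longlongrightarrow> 0) (at_right 0)"
  using barrier_tendsto assms
  by (intro tendsto_sandwich[OF _ _ tendsto_const, of "0::real" w "at_right 0" barrier])
    (auto simp: eventually_at_right_field intro!: exI[of _ 1])

definition weight' :: "real \<Rightarrow> real" where
  "weight' r = 2 * exp (barrier r) * barrier' r * weight r"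

lemma weight_deriv: "r > 0 \<Longrightarrow> (weight has_real_derivative weight' r) (at r)"
  unfolding weight_def[abs_def] weight'_def using barrier_deriv[of r]
  by (auto intro!: derivative_eq_intros)

text \<open>Since \<open>weight' = m * barrier'\<close> with \<open>m = 2 * exp barrier * weight\<close> nondecreasing, the property of
  being a supersolution is inherited from \<open>barrier\<close>, with \<open>m * A / r\<^sup>2\<close> on the right.\<close>

lemma weight_supersolution:
  assumes "r > 0"
  shows "\<exists>d. (weight' has_real_derivative d) (at r) \<and>
    (\<forall>u. u r \<ge> 0 \<longrightarrow> 2 * (exp (barrier r) * (A / r\<^sup>2) * weight r) \<le> d + damping u r * weight' r)"
proof -
  define m where "m r = 2 * exp (barrier r) * weight r" for r
  define m' where "m' = 2 * exp (barrier r) * barrier' r * weight r + 2 * exp (barrier r) * weight' r"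
  have m: "(m has_real_derivative m') (at r)"
    unfolding m_def[abs_def] m'_def using barrier_deriv[OF assms] weight_deriv[OF assms]
    by (auto intro!: derivative_eq_intros)
  have pos: "0 \<le> m r" "0 \<le> m'"
    using barrier'_nonneg[of r] by (auto simp: m_def m'_def weight_def weight'_def)
  have eq: "weight' = (\<lambda>r. m r * barrier' r)"
    by (auto simp: weight'_def m_def)
  have "(weight' has_real_derivative m' * barrier' r + m r * ((\<kappa> - 1) / r * barrier' r)) (at r)"
    unfolding eq using m barrier'_deriv[OF assms]
    by (auto intro!: derivative_eq_intros)
  moreover have "m r * (A / r\<^sup>2) \<le>
      m' * barrier' r + m r * ((\<kappa> - 1) / r * barrier' r) + damping u r * weight' r" if "u r \<ge> 0" for u
    using mult_left_mono[OF supersolution[of r u, OF assms that] pos(1)]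
      mult_nonneg_nonneg[OF pos(2) barrier'_nonneg[of r]]
    by (simp add: eq algebra_simps)
  ultimately show ?thesis
    by (intro exI conjI) (auto simp: m_def mult_ac)
qed

lemma weight'_tendsto: "((\<lambda>r. r powr N * weight' r) \<longlongrightarrow> 0) (at_right 0)"
proof -
  have "((\<lambda>r. 2 * exp (barrier r) * exp (2 * exp (barrier r)) * (r powr N * barrier' r)) \<longlongrightarrow>
      2 * exp 0 * exp (2 * exp 0) * 0) (at_right 0)"
    by (intro tendsto_intros barrier_tendsto barrier'_tendsto)
  then show ?thesis by (simp add: weight'_def weight_def mult_ac)
qed

text \<open>The difference \<open>q\<^sub>1 - q\<^sub>2\<close> solves the equation damped by \<open>u\<^sub>1\<close> with right-hand side
  \<open>(damping u\<^sub>2 - damping u\<^sub>1) * q\<^sub>2\<close>. Because \<open>q\<^sub>2 \<le> barrier'\<close>, the singular factor of this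
  difference of dampings is compensated, and what remains is at most
  \<open>exp barrier * A / r\<^sup>2 * D * weight\<close>. By \<open>weight_supersolution\<close>, \<open>D / 2 * weight'\<close> is a
  supersolution of that equation. Only \<open>u\<^sub>2 - u\<^sub>1\<close> has to be controlled: the step reverses order.\<close>

lemma contraction_one_sided:
  assumes u: "admissible u\<^sub>1" "admissible u\<^sub>2"
    and step: "bounded_step u\<^sub>1 w\<^sub>1 q\<^sub>1" "bounded_step u\<^sub>2 w\<^sub>2 q\<^sub>2"
    and D: "D \<ge> 0" "\<And>r. r > 0 \<Longrightarrow> u\<^sub>2 r - u\<^sub>1 r \<le> D * weight r" and r: "r > 0"
  shows "w\<^sub>1 r - w\<^sub>2 r \<le> D / 2 * weight r"
proof -
  have w: "(w\<^sub>1 has_real_derivative q\<^sub>1 r) (at r)" "(w\<^sub>2 has_real_derivative q\<^sub>2 r) (at r)"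
    and q: "(q\<^sub>1 has_real_derivative A / r\<^sup>2 - damping u\<^sub>1 r * q\<^sub>1 r) (at r)"
      "(q\<^sub>2 has_real_derivative A / r\<^sup>2 - damping u\<^sub>2 r * q\<^sub>2 r) (at r)"
    and bd: "0 \<le> w\<^sub>1 r" "w\<^sub>1 r \<le> barrier r" "0 \<le> w\<^sub>2 r" "w\<^sub>2 r \<le> barrier r"
      "0 \<le> q\<^sub>1 r" "q\<^sub>1 r \<le> barrier' r" "0 \<le> q\<^sub>2 r" "q\<^sub>2 r \<le> barrier' r"
    if "r > 0" for r
    using step that by (auto simp: bounded_step_def linear_step_def)
  have u_bd: "0 \<le> u\<^sub>1 r" "u\<^sub>1 r \<le> barrier r" "u\<^sub>2 r \<le> barrier r" if "r > 0" for r
    using u that by (auto simp: admissible_def)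
  obtain d where d: "\<And>r. r > 0 \<Longrightarrow> (weight' has_real_derivative d r) (at r)"
      "\<And>r u. r > 0 \<Longrightarrow> u r \<ge> 0 \<Longrightarrow>
        2 * (exp (barrier r) * (A / r\<^sup>2) * weight r) \<le> d r + damping u r * weight' r"
    using weight_supersolution by metis
  have q_le: "q\<^sub>1 r - q\<^sub>2 r - D / 2 * weight' r \<le> 0" if "r > 0" for r
  proof (rule comparison[OF continuous_on_damping damping_ge _ _ _ that])
    show "continuous_on {0<..} u\<^sub>1" using u by (simp add: admissible_def)
  next
    fix r :: real assume r: "r > 0"
    show "((\<lambda>r. q\<^sub>1 r - q\<^sub>2 r - D / 2 * weight' r) has_real_derivative
        (A / r\<^sup>2 - damping u\<^sub>1 r * q\<^sub>1 r) - (A / r\<^sup>2 - damping u\<^sub>2 r * q\<^sub>2 r) - D / 2 * d r) (at r)"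
      using q[OF r] d(1)[OF r] by (auto intro!: derivative_eq_intros)
    have "(damping u\<^sub>2 r - damping u\<^sub>1 r) * q\<^sub>2 r
        = (exp (u\<^sub>2 r) - exp (u\<^sub>1 r)) * (b * r powr (- \<kappa> - 1) * q\<^sub>2 r)"
      by (simp add: damping_def algebra_simps)
    also have "\<dots> \<le> (exp (barrier r) * (D * weight r)) * (b * r powr (- \<kappa> - 1) * q\<^sub>2 r)"
      using u_bd[OF r] D(2)[OF r] D(1) b bd(7)[OF r]
      by (intro mult_right_mono exp_diff_le) (auto simp: weight_def)
    also have "\<dots> \<le> (exp (barrier r) * (D * weight r)) * (b * r powr (- \<kappa> - 1) * barrier' r)"
      using D(1) b bd(8)[OF r] by (intro mult_left_mono) (auto simp: weight_def)
    also have "\<dots> = D / 2 * (2 * (exp (barrier r) * (A / r\<^sup>2) * weight r))"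
      using barrier'_balance[OF r] by simp
    also have "\<dots> \<le> D / 2 * (d r + damping u\<^sub>1 r * weight' r)"
      using D(1) d(2)[OF r, of u\<^sub>1] u_bd(1)[OF r] by (intro mult_left_mono) auto
    finally show "(A / r\<^sup>2 - damping u\<^sub>1 r * q\<^sub>1 r) - (A / r\<^sup>2 - damping u\<^sub>2 r * q\<^sub>2 r) - D / 2 * d r
        + damping u\<^sub>1 r * (q\<^sub>1 r - q\<^sub>2 r - D / 2 * weight' r) \<le> 0"
      by (simp add: algebra_simps)
  next
    show "((\<lambda>r. r powr N * (q\<^sub>1 r - q\<^sub>2 r - D / 2 * weight' r)) \<longlongrightarrow> 0) (at_right 0)"
    proof (rule Lim_null_comparison)
      have "((\<lambda>r. r powr N * barrier' r + D / 2 * (r powr N * weight' r)) \<longlongrightarrow> 0 + D / 2 * 0) (at_right 0)"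
        by (intro tendsto_intros barrier'_tendsto weight'_tendsto)
      then show "((\<lambda>r. r powr N * barrier' r + D / 2 * (r powr N * weight' r)) \<longlongrightarrow> 0) (at_right 0)"
        by simp
      have "norm (r powr N * (q\<^sub>1 r - q\<^sub>2 r - D / 2 * weight' r))
          \<le> r powr N * barrier' r + D / 2 * (r powr N * weight' r)" if "r > 0" for r
      proof -
        have "0 \<le> D / 2 * weight' r"
          using D(1) barrier'_nonneg[of r] by (simp add: weight'_def weight_def)
        then have "\<bar>q\<^sub>1 r - q\<^sub>2 r - D / 2 * weight' r\<bar> \<le> barrier' r + D / 2 * weight' r"
          using bd[OF that] by (simp only: abs_le_iff) linarith
        from mult_left_mono[OF this, of "r powr N"] show ?thesis
          by (simp add: abs_mult distrib_left mult.left_commute)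
      qed
      then show "eventually (\<lambda>r. norm (r powr N * (q\<^sub>1 r - q\<^sub>2 r - D / 2 * weight' r))
          \<le> r powr N * barrier' r + D / 2 * (r powr N * weight' r)) (at_right 0)"
        unfolding eventually_at_right_field by (intro exI[of _ 1]) auto
    qed
  qed
  \<comment> \<open>\<open>exp 2\<close> is the limit of the weight at \<open>0\<close>.\<close>
  have "w\<^sub>1 r - w\<^sub>2 r - D / 2 * (weight r - exp 2) \<le> 0"
  proof (rule nonpos_if_decreasing_from_zero[OF _ q_le _ r])
    fix r :: real assume r: "r > 0"
    show "((\<lambda>r. w\<^sub>1 r - w\<^sub>2 r - D / 2 * (weight r - exp 2)) has_real_derivative
        q\<^sub>1 r - q\<^sub>2 r - D / 2 * weight' r) (at r)"
      using w[OF r] weight_deriv[OF r] by (auto intro!: derivative_eq_intros)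
  next
    have "((\<lambda>r. w\<^sub>1 r - w\<^sub>2 r - D / 2 * (exp (2 * exp (barrier r)) - exp 2)) \<longlongrightarrow>
        0 - 0 - D / 2 * (exp (2 * exp 0) - exp 2)) (at_right 0)"
      using bd by (intro tendsto_intros bounded_tendsto_zero barrier_tendsto) auto
    then show "((\<lambda>r. w\<^sub>1 r - w\<^sub>2 r - D / 2 * (weight r - exp 2)) \<longlongrightarrow> 0) (at_right 0)"
      by (simp add: weight_def)
  qed
  moreover have "0 \<le> D / 2 * exp 2" using D(1) by simp
  ultimately show ?thesis by (simp add: algebra_simps)
qed

lemma contraction:
  assumes "admissible u\<^sub>1" "admissible u\<^sub>2"
    and "bounded_step u\<^sub>1 w\<^sub>1 q\<^sub>1" "bounded_step u\<^sub>2 w\<^sub>2 q\<^sub>2"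
    and "D \<ge> 0" "\<And>r. r > 0 \<Longrightarrow> \<bar>u\<^sub>1 r - u\<^sub>2 r\<bar> \<le> D * weight r" and "r > 0"
  shows "\<bar>w\<^sub>1 r - w\<^sub>2 r\<bar> \<le> D / 2 * weight r"
proof -
  have "w\<^sub>1 r - w\<^sub>2 r \<le> D / 2 * weight r"
    using assms by (intro contraction_one_sided[of u\<^sub>1 u\<^sub>2 w\<^sub>1 q\<^sub>1 w\<^sub>2 q\<^sub>2 D]) (auto simp: abs_le_iff)
  moreover have "w\<^sub>2 r - w\<^sub>1 r \<le> D / 2 * weight r"
    using assms by (intro contraction_one_sided[of u\<^sub>2 u\<^sub>1 w\<^sub>2 q\<^sub>2 w\<^sub>1 q\<^sub>1 D]) (auto simp: abs_le_iff)
  ultimately show ?thesis by linarith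
qed

lemma admissible_distance:
  assumes "admissible u\<^sub>1" "admissible u\<^sub>2" "r > 0"
  shows "\<bar>u\<^sub>1 r - u\<^sub>2 r\<bar> \<le> weight r"
proof -
  have "\<bar>u\<^sub>1 r - u\<^sub>2 r\<bar> \<le> barrier r"
    using assms by (auto simp: admissible_def abs_le_iff) (smt (verit))+
  also have "barrier r \<le> weight r"
    using exp_ge_add_one_self[of "barrier r"] exp_ge_add_one_self[of "2 * exp (barrier r)"] barrier_nonneg[of r]
    unfolding weight_def by linarith
  finally show ?thesis .
qed

lemma fixed_point_unique:
  assumes u: "admissible u\<^sub>1" "admissible u\<^sub>2"
    and step: "bounded_step u\<^sub>1 u\<^sub>1 q\<^sub>1" "bounded_step u\<^sub>2 u\<^sub>2 q\<^sub>2" and r: "r > 0"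
  shows "u\<^sub>1 r = u\<^sub>2 r"
proof -
  have "\<forall>r>0. \<bar>u\<^sub>1 r - u\<^sub>2 r\<bar> \<le> (1/2)^k * weight r" for k
  proof (induction k)
    case 0 then show ?case using admissible_distance[OF u] by simp
  next
    case (Suc k)
    then show ?case using contraction[OF u step, of "(1/2)^k"] by auto
  qed
  then have "\<bar>u\<^sub>1 r - u\<^sub>2 r\<bar> \<le> (1/2)^k * weight r" for k using r by blast
  moreover have "(\<lambda>k. (1/2::real)^k * weight r) \<longlonglongrightarrow> 0"
    by (intro tendsto_mult_left_zero LIMSEQ_power_zero) simp
  ultimately have "\<bar>u\<^sub>1 r - u\<^sub>2 r\<bar> \<le> 0"
    by (intro tendsto_lowerbound[of _ 0 sequentially]) auto
  then show ?thesis by simp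
qed

text \<open>Picard iteration from \<open>0\<close>. The errors decay like \<open>(1/2)^k * weight\<close>, uniformly on bounded
  intervals as \<open>weight\<close> is nondecreasing, so the limit \<open>u\<close> is continuous. Applying the step once more
  to the limit, and not differentiating the limit, yields the equation: by contraction the image
  of \<open>u\<close> is the limit of the same sequence.\<close>

lemma fixed_point_exists: "\<exists>u q. bounded_step u u q"
proof -
  obtain \<Phi> \<Psi> where \<Phi>: "\<And>u. admissible u \<Longrightarrow> bounded_step u (\<Phi> u) (\<Psi> u)"
    using linear_step_exists by metis
  define s where "s k = (\<Phi> ^^ k) (\<lambda>_. 0)" for k
  have s_Suc: "s (Suc k) = \<Phi> (s k)" for k by (simp add: s_def)
  have adm: "admissible (s k)" for k
  proof (induction k)
    case 0 then show ?case using barrier_nonneg by (simp add: s_def admissible_def)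
  next
    case (Suc k) then show ?case using bounded_step_admissible[OF \<Phi>] by (simp add: s_Suc)
  qed
  have step: "bounded_step (s k) (s (Suc k)) (\<Psi> (s k))" for k
    using \<Phi>[OF adm] by (simp add: s_Suc)
  have "\<forall>r>0. \<bar>s (Suc k) r - s k r\<bar> \<le> (1/2)^k * weight r" for k
  proof (induction k)
    case 0 then show ?case using admissible_distance[OF adm adm] by simp
  next
    case (Suc k)
    then show ?case using contraction[OF adm adm step step, of "(1/2)^k" "Suc k" k] by auto
  qed
  then have "\<exists>l. \<forall>k. \<bar>l - s k r\<bar> \<le> 2 * (1/2)^k * weight r" if "r > 0" for r
    using geometric_limit[of "\<lambda>k. s k r" "weight r"] that by blast
  then obtain u where u: "\<And>k r. r > 0 \<Longrightarrow> \<bar>u r - s k r\<bar> \<le> 2 * (1/2)^k * weight r"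
    by metis
  have null: "(\<lambda>k. 2 * (1/2::real)^k * c) \<longlonglongrightarrow> 0" for c
    by (intro tendsto_mult_left_zero tendsto_mult_right_zero LIMSEQ_power_zero) simp
  have lim: "(\<lambda>k. s k r) \<longlonglongrightarrow> u r" if "r > 0" for r
    using Lim_null_comparison[OF _ null[of "weight r"], of "\<lambda>k. s k r - u r"] u[OF that]
    by (simp add: Lim_null[of _ "u r"] abs_minus_commute)
  have "continuous_on {0<..<R} u" for R
  proof (rule uniform_limit_theorem)
    show "eventually (\<lambda>k. continuous_on {0<..<R} (s k)) sequentially"
      using adm by (intro always_eventually allI continuous_on_subset[of "{0<..}" _ "{0<..<R}"])
        (auto simp: admissible_def)
    show "uniform_limit {0<..<R} s u sequentially"
    proof (rule uniform_limitI)
      fix e :: real assume "e > 0"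
      then have "eventually (\<lambda>k. 2 * (1/2::real)^k * weight R < e) sequentially"
        using null[of "weight R"] by (intro order_tendstoD)
      then show "eventually (\<lambda>k. \<forall>r\<in>{0<..<R}. dist (s k r) (u r) < e) sequentially"
      proof eventually_elim
        case (elim k)
        have "weight r \<le> weight R" if "0 < r" "r < R" for r
          using that A b \<kappa> by (auto simp: weight_def barrier_def intro!: divide_right_mono mult_left_mono powr_mono2)
        then have "2 * (1/2)^k * weight r < e" if "0 < r" "r < R" for r
          using that elim by (intro le_less_trans[OF mult_left_mono elim]) auto
        then show ?case
          using u[of _ k] by (force simp: dist_real_def abs_minus_commute intro: le_less_trans)
      qed
    qed
  qed simp
  then have "isCont u r" if "r > 0" for r
    using that continuous_on_eq_continuous_at[of "{0<..<r+1}" u] by auto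
  then have "continuous_on {0<..} u"
    by (simp add: continuous_at_imp_continuous_on)
  moreover have "0 \<le> u r \<and> u r \<le> barrier r" if "r > 0" for r
    using adm that
    by (auto intro!: tendsto_lowerbound[OF lim] tendsto_upperbound[OF lim] simp: admissible_def)
  ultimately have adm_u: "admissible u" by (simp add: admissible_def)
  have fixed: "\<Phi> u r = u r" if r: "r > 0" for r
  proof -
    have "\<bar>\<Phi> u r - s (Suc k) r\<bar> \<le> 2 * (1/2)^k * weight r" for k
      using contraction[OF adm_u adm \<Phi>[OF adm_u] step, of "2 * (1/2)^k" k r] u[of _ k] r
      by (auto simp: weight_def elim: order_trans)
    then have "(\<lambda>k. s (Suc k) r - \<Phi> u r) \<longlonglongrightarrow> 0"
      by (intro Lim_null_comparison[OF _ null[of "weight r"]]) (auto simp: abs_minus_commute)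
    then have "(\<lambda>k. s (Suc k) r) \<longlonglongrightarrow> \<Phi> u r"
      by (simp add: Lim_null[of _ "\<Phi> u r"])
    then show ?thesis
      using LIMSEQ_unique LIMSEQ_Suc[OF lim[OF r]] by blast
  qed
  have "bounded_step (\<Phi> u) (\<Phi> u) (\<Psi> u)"
    using \<Phi>[OF adm_u] fixed by (simp add: bounded_step_def linear_step_def damping_def)
  then show ?thesis by blast
qed

text \<open>The product \<open>E * q\<close> is nondecreasing, and \<open>E r \<le> C * r\<close> near \<open>0\<close> because \<open>N \<ge> 1\<close>. If \<open>E * q\<close> were
  negative somewhere it would stay below a negative constant near \<open>0\<close>, and if its infimum were
  positive it would stay above a positive one; either way \<open>\<bar>q r\<bar> \<ge> c / r\<close>, against the convergence
  of \<open>u\<close>. So \<open>E * q\<close> decreases to \<open>0\<close> at \<open>0\<close>, and the comparison principle applies to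
  \<open>q - barrier'\<close>.\<close>

lemma solution_bounded:
  assumes step: "linear_step u u q" and lim: "(u \<longlongrightarrow> 0) (at_right 0)"
  shows "bounded_step u u q"
proof -
  have u: "(u has_real_derivative q r) (at r)"
    and q: "(q has_real_derivative A / r\<^sup>2 - damping u r * q r) (at r)" if "r > 0" for r
    using step that by (auto simp: linear_step_def)
  have "continuous_on {0<..} u"
    using u by (intro DERIV_continuous_on) (auto intro: has_field_derivative_at_within)
  then obtain E C where E: "\<And>r. r > 0 \<Longrightarrow> E r > 0"
      "\<And>r. r > 0 \<Longrightarrow> (E has_real_derivative damping u r * E r) (at r)"
    and C: "C > 0" "\<And>r. 0 < r \<Longrightarrow> r \<le> 1 \<Longrightarrow> E r \<le> C * r powr N"
    using integrating_factor[OF continuous_on_damping damping_ge, of u] by blast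
  have E_le: "E r \<le> C * r" if "0 < r" "r \<le> 1" for r
  proof -
    have "C * r powr N \<le> C * r powr 1"
      using that C(1) by (intro mult_left_mono powr_mono'[OF N]) auto
    then show ?thesis using C(2)[OF that] that by simp
  qed
  have K: "((\<lambda>r. E r * q r) has_real_derivative E r * (A / r\<^sup>2)) (at r)" if "r > 0" for r
    using E(2)[OF that] q[OF that] by (auto intro!: derivative_eq_intros simp: algebra_simps)
  have mono: "E s * q s \<le> E r * q r" if "0 < s" "s \<le> r" for s r
    using monotone_on_pos[OF K _ that] E(1) A by (simp add: less_imp_le)
  have inv: "c / C / r \<le> q r" if "0 < r" "r \<le> 1" "c \<le> E r * q r" "c > 0" for c r q
  proof -
    have "0 < q r" using that E(1)[of r] by (smt (verit) zero_less_mult_iff)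
    then have "c \<le> C * r * q r"
      using that mult_right_mono[OF E_le[OF that(1,2)], of "q r"] by linarith
    then show ?thesis using that C(1) by (simp add: field_simps)
  qed
  have q_nonneg: "0 \<le> q r" if r: "r > 0" for r
  proof (rule ccontr)
    assume neg: "\<not> 0 \<le> q r"
    define c where "c = E r * - q r"
    have "c > 0" using neg E(1)[OF r] by (simp add: c_def mult_pos_neg)
    then obtain s where s: "0 < s" "s \<le> min r 1" "- q s < c / C / s"
      using convergent_derivative_not_above_inverse[of "\<lambda>r. - u r" "\<lambda>r. - q r" "- 0" "c / C" "min r 1"]
        DERIV_minus[OF u] tendsto_minus[OF lim] C(1) r by auto
    moreover have "c \<le> E s * - q s" using mono[of s r] s by (simp add: c_def)
    ultimately show False using inv[of s c "\<lambda>s. - q s"] \<open>c > 0\<close> by auto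
  qed
  have small: "\<exists>r>0. E r * q r < e" if "e > 0" for e
  proof (rule ccontr)
    assume "\<not> ?thesis"
    then have "e \<le> E r * q r" if "r > 0" for r using that by force
    moreover obtain s where "0 < s" "s \<le> 1" "q s < e / C / s"
      using convergent_derivative_not_above_inverse[of u q 0 "e / C" 1] u lim C(1) \<open>e > 0\<close> by auto
    ultimately show False using inv[of s e q] \<open>e > 0\<close> by auto
  qed
  have Eq: "((\<lambda>r. E r * q r) \<longlongrightarrow> 0) (at_right 0)"
  proof (rule tendstoI)
    fix e :: real assume "e > 0"
    then obtain r where r: "r > 0" "E r * q r < e" using small by blast
    have "dist (E s * q s) 0 < e" if "0 < s" "s < r" for s
      using mono[of s r] r that q_nonneg[of s] E(1)[of s] by simp
    then show "eventually (\<lambda>s. dist (E s * q s) 0 < e) (at_right 0)"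
      unfolding eventually_at_right_field using r by auto
  qed
  have EU: "((\<lambda>r. E r * barrier' r) \<longlongrightarrow> 0) (at_right 0)"
  proof (rule Lim_null_comparison)
    show "((\<lambda>r. C * (r powr N * barrier' r)) \<longlongrightarrow> 0) (at_right 0)"
      by (intro tendsto_mult_right_zero barrier'_tendsto)
    have "norm (E r * barrier' r) \<le> C * (r powr N * barrier' r)" if "0 < r" "r \<le> 1" for r
      using mult_right_mono[OF C(2)[OF that] barrier'_nonneg[of r]] E(1)[of r] barrier'_nonneg[of r] that
      by (simp add: abs_mult mult.assoc)
    then show "eventually (\<lambda>r. norm (E r * barrier' r) \<le> C * (r powr N * barrier' r)) (at_right 0)"
      unfolding eventually_at_right_field by (intro exI[of _ 1]) auto
  qed
  have u_nonneg: "0 \<le> u r" if "r > 0" for r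
    using nonpos_if_decreasing_from_zero[of "\<lambda>r. - u r" "\<lambda>r. - q r" r]
      DERIV_minus[OF u] tendsto_minus[OF lim] q_nonneg that by simp
  have q_le: "q r \<le> barrier' r" if "r > 0" for r
  proof -
    have "q r - barrier' r \<le> 0"
    proof (rule comparison_with_factor[OF E _ _ _ that])
      fix r :: real assume r: "r > 0"
      show "((\<lambda>r. q r - barrier' r) has_real_derivative
          (A / r\<^sup>2 - damping u r * q r) - (\<kappa> - 1) / r * barrier' r) (at r)"
        using q[OF r] barrier'_deriv[OF r] by (intro DERIV_diff)
      show "(A / r\<^sup>2 - damping u r * q r) - (\<kappa> - 1) / r * barrier' r + damping u r * (q r - barrier' r) \<le> 0"
        using supersolution[of r u, OF r u_nonneg[OF r]] by (simp add: algebra_simps)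
    next
      show "((\<lambda>r. E r * (q r - barrier' r)) \<longlongrightarrow> 0) (at_right 0)"
        using tendsto_diff[OF Eq EU] by (simp add: algebra_simps)
    qed
    then show ?thesis by simp
  qed
  have "u r \<le> barrier r" if "r > 0" for r
    using nonpos_if_decreasing_from_zero[of "\<lambda>r. u r - barrier r" "\<lambda>r. q r - barrier' r" r]
      DERIV_diff[OF u barrier_deriv] tendsto_diff[OF lim barrier_tendsto] q_le that by simp
  then show ?thesis
    using step u_nonneg q_nonneg q_le by (simp add: bounded_step_def)
qed

end

section \<open>Translation to the original equation\<close>

locale singular_problem =
  fixes n :: nat and \<alpha> \<beta> \<eta> :: real
  assumes n: "n \<ge> 3" and \<beta>: "\<beta> > 0" and \<eta>: "\<eta> > 0" and \<alpha>: "\<alpha> > 2 * \<beta>"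
begin

definition \<gamma> :: real where "\<gamma> = \<alpha> / \<beta>"

lemma \<gamma>: "\<gamma> > 2" "\<alpha> = \<beta> * \<gamma>"
  using \<alpha> \<beta> by (auto simp: \<gamma>_def field_simps)

sublocale profile_equation "real n - 1" "\<gamma> - 2" "\<beta> * \<eta>" "\<gamma> * (real n - 2)"
  using n \<beta> \<eta> \<gamma> by unfold_locales auto

definition from_profile :: "(real \<Rightarrow> real) \<Rightarrow> real \<Rightarrow> real" where
  "from_profile u r = \<eta> * r powr (- \<gamma>) * exp (u r)"

text \<open>The left-hand side of the radial equation for \<open>g = from_profile u\<close>, where \<open>q = u'\<close> and \<open>u''\<close> has
  been replaced by its value from the desingularised equation. Here \<open>q - \<gamma> / r\<close> is the logarithmic
  derivative of \<open>g\<close>.\<close>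

lemma radial_balance:
  assumes "r > 0"
  shows "(\<gamma> * (real n - 2) / r\<^sup>2 - damping u r * q) + \<gamma> / r\<^sup>2 + (real n - 1) / r * (q - \<gamma> / r)
    + \<alpha> * from_profile u r + \<beta> * r * (from_profile u r * (q - \<gamma> / r)) = 0"
proof -
  have "r powr (- (\<gamma> - 2) - 1) = r * r powr (- \<gamma>)"
    using assms powr_add[of r 1 "- \<gamma>"] by simp
  then have "damping u r * q = (real n - 1) / r * q + \<beta> * r * from_profile u r * q"
    by (simp add: damping_def from_profile_def algebra_simps)
  moreover have "(real n - 1) * \<gamma> = \<gamma> * (real n - 2) + \<gamma>"
    by (simp add: algebra_simps)
  then have "(real n - 1) / r * (\<gamma> / r) = \<gamma> * (real n - 2) / r\<^sup>2 + \<gamma> / r\<^sup>2"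
    by (simp only: times_divide_times_eq power2_eq_square add_divide_distrib)
  moreover have "\<beta> * r * (from_profile u r * (\<gamma> / r)) = \<alpha> * from_profile u r"
    using assms by (simp add: \<gamma>(2)[symmetric])
  ultimately show ?thesis
    by (simp add: right_diff_distrib mult.assoc)
qed

lemma solution_from_profile:
  assumes step: "bounded_step u u q"
  shows "singular_solution n \<alpha> \<beta> \<eta> (from_profile u)"
proof -
  define g where "g = from_profile u"
  define q' where "q' r = \<gamma> * (real n - 2) / r\<^sup>2 - damping u r * q r" for r
  have u: "(u has_real_derivative q r) (at r)"
    and q: "(q has_real_derivative q' r) (at r)" if "r > 0" for r
    using step that by (auto simp: bounded_step_def linear_step_def q'_def)
  have g_pos: "g r > 0" if "r > 0" for r
    using that \<eta> by (simp add: g_def from_profile_def)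
  have g1: "(g has_real_derivative g r * (q r - \<gamma> / r)) (at r)" if "r > 0" for r
  proof -
    have "((\<lambda>r. \<eta> * r powr (- \<gamma>) * exp (u r)) has_real_derivative
        \<eta> * (- \<gamma> * r powr (- \<gamma> - 1)) * exp (u r) + exp (u r) * q r * (\<eta> * r powr (- \<gamma>))) (at r)"
      using DERIV_mult[OF DERIV_cmult[OF has_real_derivative_powr[OF that, of "- \<gamma>"]] DERIV_fun_exp[OF u[OF that]]] .
    moreover have "r powr (- \<gamma> - 1) = r powr (- \<gamma>) / r"
      using that by (simp add: powr_diff)
    ultimately show ?thesis
      by (simp add: g_def from_profile_def[abs_def] algebra_simps)
  qed
  have dg: "deriv g r = g r * (q r - \<gamma> / r)" if "r > 0" for r
    using g1[OF that] by (rule DERIV_imp_deriv)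
  have p1: "((\<lambda>r. q r - \<gamma> / r) has_real_derivative q' r + \<gamma> / r\<^sup>2) (at r)" if "r > 0" for r
    using q[OF that] that by (auto intro!: derivative_eq_intros simp: power2_eq_square)
  define g2 where "g2 r = g r * (q r - \<gamma> / r) * (q r - \<gamma> / r) + (q' r + \<gamma> / r\<^sup>2) * g r" for r
  have g2: "(deriv g has_real_derivative g2 r) (at r)" if "r > 0" for r
    unfolding g2_def using that dg
    by (intro has_field_derivative_transform_within_open
        [OF DERIV_mult[OF g1[OF that] p1[OF that]], of "{0<..}" "deriv g"]) auto
  have quot: "deriv (\<lambda>s. deriv g s / g s) r = q' r + \<gamma> / r\<^sup>2" if "r > 0" for r
    using that dg g_pos
    by (intro DERIV_imp_deriv has_field_derivative_transform_within_open
        [OF p1[OF that], of "{0<..}" "\<lambda>s. deriv g s / g s"]) (auto simp: less_imp_neq[symmetric])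
  have "continuous_on {0<..} u" "continuous_on {0<..} q" "continuous_on {0<..} g"
    using u q g1 by (auto intro!: DERIV_continuous_on intro: has_field_derivative_at_within)
  then have "continuous_on {0<..} g2"
    unfolding g2_def q'_def by (intro continuous_intros continuous_on_damping) auto
  then have "continuous_on {0<..} (deriv (deriv g))"
    using g2 by (subst continuous_on_cong[OF refl, of _ _ g2]) (auto intro: DERIV_imp_deriv)
  moreover have "g differentiable_on {0<..}" "deriv g differentiable_on {0<..}"
    using g1 g2 unfolding differentiable_on_def real_differentiable_def greaterThan_iff
    by (blast intro: has_field_derivative_at_within)+
  ultimately have "Ck_on 2 {0<..} g"
    by (auto simp: Ck_on_def numeral_2_eq_2 less_Suc_eq)
  moreover have "radial_eq_at n \<alpha> \<beta> g r" if "r > 0" for r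
    using radial_balance[OF that, of u "q r", folded g_def] g_pos[OF that]
    unfolding radial_eq_at_def quot[OF that] dg[OF that] q'_def by simp
  moreover have "((\<lambda>r. r powr (\<alpha> / \<beta>) * g r) \<longlongrightarrow> \<eta>) (at_right 0)"
  proof -
    have "((\<lambda>r. \<eta> * exp (u r)) \<longlongrightarrow> \<eta> * exp 0) (at_right 0)"
      using step by (intro tendsto_intros bounded_tendsto_zero) (auto simp: bounded_step_def)
    moreover have "eventually (\<lambda>r. \<eta> * exp (u r) = r powr (\<alpha> / \<beta>) * g r) (at_right 0)"
      by (auto simp: eventually_at_filter g_def from_profile_def \<gamma>_def powr_minus field_simps)
    ultimately show ?thesis
      by (simp add: Lim_transform_eventually)
  qed
  ultimately show ?thesis
    using g_pos by (simp add: singular_solution_def flip: g_def)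
qed

lemma profile_of_solution:
  assumes h: "singular_solution n \<alpha> \<beta> \<eta> h"
  shows "\<exists>u q. bounded_step u u q \<and> (\<forall>r>0. h r = from_profile u r)"
proof -
  define u where "u r = ln (r powr \<gamma> * h r / \<eta>)" for r
  \<comment> \<open>The logarithmic derivative of \<open>r powr \<gamma> * h r\<close>, hence \<open>u'\<close>.\<close>
  define q where "q r = deriv h r / h r + \<gamma> / r" for r
  have h_pos: "h r > 0" and eq: "radial_eq_at n \<alpha> \<beta> h r" if "r > 0" for r
    using h that by (auto simp: singular_solution_def)
  have h_eq: "h r = from_profile u r" if "r > 0" for r
    using that h_pos[OF that] \<eta> by (simp add: from_profile_def u_def powr_minus field_simps)
  have "h differentiable_on {0<..}" "deriv h differentiable_on {0<..}"
    using h by (auto simp: singular_solution_def Ck_on_def numeral_2_eq_2 less_Suc_eq all_conj_distrib)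
  then have h1: "(h has_real_derivative deriv h r) (at r)"
    and h2: "(deriv h has_real_derivative deriv (deriv h) r) (at r)" if "r > 0" for r
    using that by (auto simp: differentiable_on_eq_differentiable_at DERIV_deriv_iff_real_differentiable)
  have u1: "(u has_real_derivative q r) (at r)" if "r > 0" for r
  proof -
    have der: "((\<lambda>r. ln (h r) + \<gamma> * ln r - ln \<eta>) has_real_derivative q r) (at r)"
      using h1[OF that] h_pos[OF that] that
      by (auto intro!: derivative_eq_intros simp: q_def)
    have log: "ln (h x) + \<gamma> * ln x - ln \<eta> = u x" if "x \<in> {0<..}" for x
      using that h_pos[of x] \<eta> by (simp add: u_def ln_div ln_mult_pos)
    show ?thesis
      by (rule has_field_derivative_transform_within_open[OF der open_greaterThan _ log])
        (use that in simp_all)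
  qed
  define d where "d r = deriv (\<lambda>s. deriv h s / h s) r" for r
  have q1: "(q has_real_derivative d r - \<gamma> / r\<^sup>2) (at r)" if "r > 0" for r
  proof -
    have "(\<lambda>s. deriv h s / h s) field_differentiable at r"
      using h1[OF that] h2[OF that] h_pos[OF that]
      by (intro field_differentiable_divide) (auto simp: field_differentiable_def)
    then have "((\<lambda>s. deriv h s / h s) has_real_derivative d r) (at r)"
      by (simp add: d_def field_differentiable_derivI)
    moreover have "((\<lambda>r. \<gamma> / r) has_real_derivative - (\<gamma> / r\<^sup>2)) (at r)"
      using that by (auto intro!: derivative_eq_intros simp: power2_eq_square)
    ultimately show ?thesis
      unfolding q_def[abs_def] by (auto dest: DERIV_add)
  qed
  have "d r - \<gamma> / r\<^sup>2 = \<gamma> * (real n - 2) / r\<^sup>2 - damping u r * q r" if "r > 0" for r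
  proof -
    have "deriv h r = h r * (q r - \<gamma> / r)"
      using h_pos[OF that] by (simp add: q_def)
    moreover from this have "deriv h r / h r = q r - \<gamma> / r"
      using h_pos[OF that] by simp
    ultimately have "d r + (real n - 1) / r * (q r - \<gamma> / r) + \<alpha> * h r + \<beta> * r * (h r * (q r - \<gamma> / r)) = 0"
      using eq[OF that] unfolding radial_eq_at_def d_def[symmetric] by (simp only:)
    also note radial_balance[OF that, of u "q r", folded h_eq[OF that], symmetric]
    finally show ?thesis by (simp only: add_right_cancel) simp
  qed
  then have "linear_step u u q"
    using u1 q1 by (simp add: linear_step_def)
  moreover have "(u \<longlongrightarrow> 0) (at_right 0)"
  proof -
    have "((\<lambda>r. ln (r powr \<gamma> * h r / \<eta>)) \<longlongrightarrow> ln (\<eta> / \<eta>)) (at_right 0)"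
      using h \<eta> by (intro tendsto_intros) (auto simp: singular_solution_def \<gamma>_def)
    then show ?thesis using \<eta> by (simp add: u_def[abs_def])
  qed
  ultimately show ?thesis
    using solution_bounded h_eq by blast
qed

end

theorem theorem1p2:
  fixes n :: nat and \<eta> \<rho>\<^sub>1 \<alpha>\<^sub>0 \<beta>\<^sub>0 :: real
  assumes "n \<ge> 3" and "\<eta> > 0" and "\<rho>\<^sub>1 > 0" and "\<beta>\<^sub>0 > 0"
    and "\<alpha>\<^sub>0 = 2 * \<beta>\<^sub>0 + \<rho>\<^sub>1"
  shows "\<exists>g. singular_solution n \<alpha>\<^sub>0 \<beta>\<^sub>0 \<eta> g \<and>
           (\<forall>h. singular_solution n \<alpha>\<^sub>0 \<beta>\<^sub>0 \<eta> h \<longrightarrow> (\<forall>r>0. h r = g r))"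
proof -
  interpret singular_problem n \<alpha>\<^sub>0 \<beta>\<^sub>0 \<eta>
    using assms by unfold_locales auto
  obtain u q where u: "bounded_step u u q"
    using fixed_point_exists by blast
  have "h r = from_profile u r" if h: "singular_solution n \<alpha>\<^sub>0 \<beta>\<^sub>0 \<eta> h" and r: "r > 0" for h r
  proof -
    obtain v p where v: "bounded_step v v p" and eq: "\<And>r. r > 0 \<Longrightarrow> h r = from_profile v r"
      using profile_of_solution[OF h] by blast
    have "v r = u r"
      using fixed_point_unique[OF _ _ v u r] bounded_step_admissible u v by blast
    then show ?thesis using eq[OF r] by (simp add: from_profile_def)
  qed
  then show ?thesis using solution_from_profile[OF u] by blast
qed

end
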